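(* Suppose $\lambda\in\mathfrak h^*$ is simply-regular, i.e. $\lambda(h_i)\ne0$ for all $i\in I$, and let $\mathbb V^\lambda$ be an arbitrary highest weight $\mathfrak g$-module with highest weight $\lambda$. Then the face map, which sends a subset $J\subset I$ to the subset $\operatorname{wt}_J\mathbb V^\lambda$ of $\operatorname{wt}\mathbb V^\lambda$, is one-to-one.
   Context: $\mathfrak g$ is a complex finite-dimensional semisimple Lie algebra with fixed triangular decomposition $\mathfrak g=\mathfrak n^+\oplus\mathfrak h\oplus\mathfrak n^-$, simple roots $\Delta=\{\alpha_i:i\in I\}$ and simple coroots $h_i\in\mathfrak h$. A highest weight module $\mathbb V^\lambda$ is a nonzero quotient of the Verma module $M(\lambda)$; $\operatorname{wt}\mathbb V^\lambda$ is its set of weights. For $J\subset I$, $\Delta_J=\{\alpha_j:j\in J\}$ and $\operatorname{wt}_J\mathbb V^\lambda:=\operatorname{wt}\mathbb V^\lambda\cap(\lambda-\mathbb Z_+\Delta_J)$. *)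

theory Defs
  imports Complex_Main "HOL-Library.Poly_Mapping"
begin

class complex_vec = ab_group_add +
  fixes cscale :: "complex \<Rightarrow> 'a \<Rightarrow> 'a"  (infixr "*\<^sub>C" 75)
  assumes cscale_add_right: "c *\<^sub>C (x + y) = c *\<^sub>C x + c *\<^sub>C y"
    and cscale_add_left: "(c + d) *\<^sub>C x = c *\<^sub>C x + d *\<^sub>C x"
    and cscale_cscale: "c *\<^sub>C d *\<^sub>C x = (c * d) *\<^sub>C x"
    and cscale_one: "1 *\<^sub>C x = x"

global_interpretation cvec: vector_space "cscale :: complex \<Rightarrow> 'a \<Rightarrow> 'a :: complex_vec"
  by unfold_locales
    (simp_all add: cscale_add_right cscale_add_left cscale_cscale cscale_one)

class lie_algebra = complex_vec +
  fixes bracket :: "'a \<Rightarrow> 'a \<Rightarrow> 'a"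
  assumes bracket_add_left: "bracket (x + y) z = bracket x z + bracket y z"
    and bracket_add_right: "bracket x (y + z) = bracket x y + bracket x z"
    and bracket_cscale_left: "bracket (c *\<^sub>C x) y = c *\<^sub>C bracket x y"
    and bracket_cscale_right: "bracket x (c *\<^sub>C y) = c *\<^sub>C bracket x y"
    and bracket_self: "bracket x x = 0"
    and jacobi: "bracket x (bracket y z) + bracket y (bracket z x) + bracket z (bracket x y) = 0"

definition finite_dim :: "'a :: complex_vec itself \<Rightarrow> bool" where
  "finite_dim _ \<longleftrightarrow> (\<exists>B :: 'a set. finite B \<and> cvec.span B = UNIV)"

definition bracket_span :: "'g :: lie_algebra set \<Rightarrow> 'g set \<Rightarrow> 'g set" where
  "bracket_span A B = cvec.span {bracket a b | a b. a \<in> A \<and> b \<in> B}"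

definition lie_subalgebra :: "'g :: lie_algebra set \<Rightarrow> bool" where
  "lie_subalgebra A \<longleftrightarrow> cvec.subspace A \<and> (\<forall>a\<in>A. \<forall>b\<in>A. bracket a b \<in> A)"

definition lie_ideal :: "'g :: lie_algebra set \<Rightarrow> bool" where
  "lie_ideal A \<longleftrightarrow> cvec.subspace A \<and> (\<forall>x. \<forall>a\<in>A. bracket x a \<in> A)"

primrec derived_series :: "'g :: lie_algebra set \<Rightarrow> nat \<Rightarrow> 'g set" where
  "derived_series A 0 = A"
| "derived_series A (Suc n) = bracket_span (derived_series A n) (derived_series A n)"

primrec lower_central_series :: "'g :: lie_algebra set \<Rightarrow> nat \<Rightarrow> 'g set" where
  "lower_central_series A 0 = A"
| "lower_central_series A (Suc n) = bracket_span A (lower_central_series A n)"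

definition lie_solvable :: "'g :: lie_algebra set \<Rightarrow> bool" where
  "lie_solvable A \<longleftrightarrow> (\<exists>n. derived_series A n = {0})"

definition lie_nilpotent :: "'g :: lie_algebra set \<Rightarrow> bool" where
  "lie_nilpotent A \<longleftrightarrow> (\<exists>n. lower_central_series A n = {0})"

definition semisimple :: "'g :: lie_algebra itself \<Rightarrow> bool" where
  "semisimple _ \<longleftrightarrow> (\<forall>A :: 'g set. lie_ideal A \<and> lie_solvable A \<longrightarrow> A = {0})"

definition cartan_subalgebra :: "'g :: lie_algebra set \<Rightarrow> bool" where
  "cartan_subalgebra H \<longleftrightarrow> lie_subalgebra H \<and> lie_nilpotent H \<and>
     (\<forall>x. (\<forall>y\<in>H. bracket x y \<in> H) \<longrightarrow> x \<in> H)"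

text \<open>
  A linear functional on a subspace \<open>H\<close> is represented by a function on the whole type that
  is linear on \<open>H\<close> and vanishes outside \<open>H\<close>, so that functionals on \<open>H\<close> that agree on \<open>H\<close>
  are equal.
\<close>

definition dual_space :: "'g :: complex_vec set \<Rightarrow> ('g \<Rightarrow> complex) set" where
  "dual_space H = {\<phi>. (\<forall>x\<in>H. \<forall>y\<in>H. \<phi> (x + y) = \<phi> x + \<phi> y) \<and>
     (\<forall>c. \<forall>x\<in>H. \<phi> (c *\<^sub>C x) = c * \<phi> x) \<and> (\<forall>x. x \<notin> H \<longrightarrow> \<phi> x = 0)}"

definition weight_space ::
    "('g \<Rightarrow> 'v \<Rightarrow> 'v :: complex_vec) \<Rightarrow> 'g set \<Rightarrow> ('g \<Rightarrow> complex) \<Rightarrow> 'v set" where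
  "weight_space act H \<mu> = {v. \<forall>x\<in>H. act x v = \<mu> x *\<^sub>C v}"

definition weights ::
    "('g :: complex_vec \<Rightarrow> 'v \<Rightarrow> 'v :: complex_vec) \<Rightarrow> 'g set \<Rightarrow> ('g \<Rightarrow> complex) set" where
  "weights act H = {\<mu> \<in> dual_space H. weight_space act H \<mu> \<noteq> {0}}"

definition roots :: "'g :: lie_algebra set \<Rightarrow> ('g \<Rightarrow> complex) set" where
  "roots H = weights bracket H - {\<lambda>_. 0}"

definition root_space :: "'g :: lie_algebra set \<Rightarrow> ('g \<Rightarrow> complex) \<Rightarrow> 'g set" where
  "root_space H \<beta> = weight_space bracket H \<beta>"

definition nonneg_combs :: "('i \<Rightarrow> 'g \<Rightarrow> complex) \<Rightarrow> 'i set \<Rightarrow> ('g \<Rightarrow> complex) set" where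
  "nonneg_combs \<alpha> J = {\<lambda>x. \<Sum>j\<in>J. of_nat (n j) * \<alpha> j x | n :: 'i \<Rightarrow> nat. True}"

definition simple_roots ::
    "'g :: lie_algebra set \<Rightarrow> 'i set \<Rightarrow> ('i \<Rightarrow> 'g \<Rightarrow> complex) \<Rightarrow> bool" where
  "simple_roots H I \<alpha> \<longleftrightarrow> finite I \<and> \<alpha> ` I \<subseteq> roots H \<and>
     (\<forall>c :: 'i \<Rightarrow> complex. (\<forall>x\<in>H. (\<Sum>i\<in>I. c i * \<alpha> i x) = 0) \<longrightarrow> (\<forall>i\<in>I. c i = 0)) \<and>
     (\<forall>\<beta>\<in>roots H. \<beta> \<in> nonneg_combs \<alpha> I \<or> (\<lambda>x. - \<beta> x) \<in> nonneg_combs \<alpha> I)"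

definition positive_roots ::
    "'g :: lie_algebra set \<Rightarrow> 'i set \<Rightarrow> ('i \<Rightarrow> 'g \<Rightarrow> complex) \<Rightarrow> ('g \<Rightarrow> complex) set" where
  "positive_roots H I \<alpha> = roots H \<inter> nonneg_combs \<alpha> I"

definition triangular_decomposition ::
    "'g :: lie_algebra set \<Rightarrow> 'g set \<Rightarrow> 'g set \<Rightarrow> 'i set \<Rightarrow> ('i \<Rightarrow> 'g \<Rightarrow> complex) \<Rightarrow> bool" where
  "triangular_decomposition np H nm I \<alpha> \<longleftrightarrow>
     cartan_subalgebra H \<and> simple_roots H I \<alpha> \<and>
     np = cvec.span (\<Union>\<beta>\<in>positive_roots H I \<alpha>. root_space H \<beta>) \<and>
     nm = cvec.span (\<Union>\<beta>\<in>positive_roots H I \<alpha>. root_space H (\<lambda>x. - \<beta> x)) \<and>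
     (\<forall>x. \<exists>!(a, b, c). a \<in> np \<and> b \<in> H \<and> c \<in> nm \<and> x = a + b + c)"

text \<open>
  The line \<open>[g_\<beta>, g_{-\<beta>}]\<close> contains exactly one element on which the root \<open>\<beta>\<close> takes the
  value 2, the coroot of \<open>\<beta>\<close>.
\<close>

definition is_coroot :: "'g :: lie_algebra set \<Rightarrow> ('g \<Rightarrow> complex) \<Rightarrow> 'g \<Rightarrow> bool" where
  "is_coroot H \<beta> t \<longleftrightarrow>
     t \<in> bracket_span (root_space H \<beta>) (root_space H (\<lambda>x. - \<beta> x)) \<and> \<beta> t = 2"

text \<open>
  The free associative algebra on the set \<open>'g\<close> is the monoid algebra of the free monoid on
  \<open>'g\<close>.  Its quotient by the linear relations of \<open>'g\<close> is the tensor algebra; the enveloping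
  algebra imposes in addition the relations \<open>x y - y x = [x, y]\<close>.
\<close>

datatype 'a free_monoid = Word (letters: "'a list")

instantiation free_monoid :: (type) monoid_add
begin

definition "0 = Word []"
definition "u + w = Word (letters u @ letters w)"

instance
  by intro_classes (simp_all add: zero_free_monoid_def plus_free_monoid_def)

end

type_synonym 'a free_algebra = "'a free_monoid \<Rightarrow>\<^sub>0 complex"

definition gen :: "'a \<Rightarrow> 'a free_algebra" where
  "gen x = Poly_Mapping.single (Word [x]) 1"

definition scalar :: "complex \<Rightarrow> 'a free_algebra" where
  "scalar c = Poly_Mapping.single 0 c"

inductive_set env_ideal :: "'g :: lie_algebra free_algebra set" where
  add_rel: "gen (x + y) - (gen x + gen y) \<in> env_ideal"
| cscale_rel: "gen (c *\<^sub>C x) - scalar c * gen x \<in> env_ideal"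
| bracket_rel: "gen (bracket x y) - (gen x * gen y - gen y * gen x) \<in> env_ideal"
| zero: "0 \<in> env_ideal"
| add: "a \<in> env_ideal \<Longrightarrow> b \<in> env_ideal \<Longrightarrow> a + b \<in> env_ideal"
| mult: "a \<in> env_ideal \<Longrightarrow> r * a * s \<in> env_ideal"

lemma env_ideal_mult_left: "a \<in> env_ideal \<Longrightarrow> r * a \<in> env_ideal"
  using env_ideal.mult[of a r 1] by simp

lemma env_ideal_mult_right: "a \<in> env_ideal \<Longrightarrow> a * r \<in> env_ideal"
  using env_ideal.mult[of a 1 r] by simp

lemma env_ideal_minus: "a \<in> env_ideal \<Longrightarrow> - a \<in> env_ideal"
  using env_ideal_mult_left[of a "- 1"] by simp

lemma env_ideal_diff: "a \<in> env_ideal \<Longrightarrow> b \<in> env_ideal \<Longrightarrow> a - b \<in> env_ideal"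
  using env_ideal.add[of a "- b"] env_ideal_minus[of b] by simp

lemma scalar_add: "scalar (c + d) = scalar c + scalar d"
  by (simp add: scalar_def single_add)

lemma scalar_mult: "scalar (c * d) = scalar c * scalar d"
  by (simp add: scalar_def mult_single)

lemma scalar_one: "scalar 1 = 1"
  by (simp add: scalar_def)

definition env_rel :: "'g :: lie_algebra free_algebra \<Rightarrow> 'g free_algebra \<Rightarrow> bool" where
  "env_rel a b \<longleftrightarrow> a - b \<in> env_ideal"

lemma equivp_env_rel: "equivp (env_rel :: 'a :: lie_algebra free_algebra \<Rightarrow> _)"
proof (rule equivpI)
  show "reflp (env_rel :: 'a free_algebra \<Rightarrow> _)"
    by (simp add: reflp_def env_rel_def env_ideal.zero)
  show "symp (env_rel :: 'a free_algebra \<Rightarrow> _)"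
  proof (rule sympI)
    fix a b :: "'a free_algebra"
    assume "env_rel a b"
    then have "- (a - b) \<in> env_ideal"
      unfolding env_rel_def by (rule env_ideal_minus)
    then show "env_rel b a"
      by (simp add: env_rel_def)
  qed
  show "transp (env_rel :: 'a free_algebra \<Rightarrow> _)"
  proof (rule transpI)
    fix a b c :: "'a free_algebra"
    assume "env_rel a b" "env_rel b c"
    then have "(a - b) + (b - c) \<in> env_ideal"
      unfolding env_rel_def by (rule env_ideal.add)
    then show "env_rel a c"
      by (simp add: env_rel_def)
  qed
qed

lemma env_rel_eqI: "a = b \<Longrightarrow> env_rel a b"
  by (simp add: env_rel_def env_ideal.zero)

quotient_type (overloaded) 'g uea = "'g :: lie_algebra free_algebra" / env_rel
  by (rule equivp_env_rel)

instantiation uea :: (lie_algebra) "{ring, monoid_mult, complex_vec}"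
begin

lift_definition zero_uea :: "'a uea" is 0 .
lift_definition one_uea :: "'a uea" is 1 .

lift_definition plus_uea :: "'a uea \<Rightarrow> 'a uea \<Rightarrow> 'a uea" is "(+)"
proof -
  fix a b c d :: "'a free_algebra"
  assume "env_rel a b" "env_rel c d"
  then have "(a - b) + (c - d) \<in> env_ideal"
    unfolding env_rel_def by (rule env_ideal.add)
  then show "env_rel (a + c) (b + d)"
    by (simp add: env_rel_def algebra_simps)
qed

lift_definition uminus_uea :: "'a uea \<Rightarrow> 'a uea" is uminus
proof -
  fix a b :: "'a free_algebra"
  assume "env_rel a b"
  then have "- (a - b) \<in> env_ideal"
    unfolding env_rel_def by (rule env_ideal_minus)
  then show "env_rel (- a) (- b)"
    by (simp add: env_rel_def)
qed

lift_definition minus_uea :: "'a uea \<Rightarrow> 'a uea \<Rightarrow> 'a uea" is "(-)"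
proof -
  fix a b c d :: "'a free_algebra"
  assume "env_rel a b" "env_rel c d"
  then have "(a - b) - (c - d) \<in> env_ideal"
    unfolding env_rel_def by (rule env_ideal_diff)
  then show "env_rel (a - c) (b - d)"
    by (simp add: env_rel_def algebra_simps)
qed

lift_definition times_uea :: "'a uea \<Rightarrow> 'a uea \<Rightarrow> 'a uea" is "(*)"
proof -
  fix a b c d :: "'a free_algebra"
  assume "env_rel a b" "env_rel c d"
  then have "a * (c - d) + (a - b) * d \<in> env_ideal"
    unfolding env_rel_def
    by (intro env_ideal.add env_ideal_mult_left env_ideal_mult_right)
  then show "env_rel (a * c) (b * d)"
    by (simp add: env_rel_def algebra_simps)
qed

lift_definition cscale_uea :: "complex \<Rightarrow> 'a uea \<Rightarrow> 'a uea" is "\<lambda>c a. scalar c * a"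
  by (simp add: env_rel_def env_ideal_mult_left flip: right_diff_distrib)

instance
proof
  fix a b c :: "'a uea" and r t :: complex
  show "a + b + c = a + (b + c)"
    by transfer (rule env_rel_eqI, simp add: add.assoc)
  show "a + b = b + a"
    by transfer (rule env_rel_eqI, simp add: add.commute)
  show "0 + a = a"
    by transfer (rule env_rel_eqI, simp)
  show "- a + a = 0"
    by transfer (rule env_rel_eqI, simp)
  show "a - b = a + - b"
    by transfer (rule env_rel_eqI, simp)
  show "a * b * c = a * (b * c)"
    by transfer (rule env_rel_eqI, simp add: mult.assoc)
  show "(a + b) * c = a * c + b * c"
    by transfer (rule env_rel_eqI, simp add: distrib_right)
  show "a * (b + c) = a * b + a * c"
    by transfer (rule env_rel_eqI, simp add: distrib_left)
  show "1 * a = a"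
    by transfer (rule env_rel_eqI, simp)
  show "a * 1 = a"
    by transfer (rule env_rel_eqI, simp)
  show "r *\<^sub>C (a + b) = r *\<^sub>C a + r *\<^sub>C b"
    by transfer (rule env_rel_eqI, simp add: distrib_left)
  show "(r + t) *\<^sub>C a = r *\<^sub>C a + t *\<^sub>C a"
    by transfer (rule env_rel_eqI, simp add: scalar_add distrib_right)
  show "r *\<^sub>C t *\<^sub>C a = (r * t) *\<^sub>C a"
    by transfer (rule env_rel_eqI, simp add: scalar_mult mult.assoc)
  show "1 *\<^sub>C a = a"
    by transfer (rule env_rel_eqI, simp add: scalar_one)
qed

end

lift_definition \<iota> :: "'g :: lie_algebra \<Rightarrow> 'g uea" is gen .

definition lie_module :: "('g :: lie_algebra \<Rightarrow> 'v \<Rightarrow> 'v :: complex_vec) \<Rightarrow> bool" where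
  "lie_module act \<longleftrightarrow>
     (\<forall>x y v. act (x + y) v = act x v + act y v) \<and>
     (\<forall>x v w. act x (v + w) = act x v + act x w) \<and>
     (\<forall>c x v. act (c *\<^sub>C x) v = c *\<^sub>C act x v) \<and>
     (\<forall>c x v. act x (c *\<^sub>C v) = c *\<^sub>C act x v) \<and>
     (\<forall>x y v. act (bracket x y) v = act x (act y v) - act y (act x v))"

text \<open>
  The Verma module of highest weight \<open>lam\<close> is the quotient of the enveloping algebra by the left
  ideal generated by \<open>np\<close> and all \<open>x - lam x\<close> with \<open>x \<in> H\<close>.
\<close>

inductive_set verma_ideal ::
    "'g :: lie_algebra set \<Rightarrow> 'g set \<Rightarrow> ('g \<Rightarrow> complex) \<Rightarrow> 'g uea set"
  for np H :: "'g set" and lam :: "'g \<Rightarrow> complex" where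
  np: "x \<in> np \<Longrightarrow> \<iota> x \<in> verma_ideal np H lam"
| H: "x \<in> H \<Longrightarrow> \<iota> x - lam x *\<^sub>C 1 \<in> verma_ideal np H lam"
| zero: "0 \<in> verma_ideal np H lam"
| add: "a \<in> verma_ideal np H lam \<Longrightarrow> b \<in> verma_ideal np H lam \<Longrightarrow> a + b \<in> verma_ideal np H lam"
| mult: "a \<in> verma_ideal np H lam \<Longrightarrow> u * a \<in> verma_ideal np H lam"

definition verma_rel ::
    "'g :: lie_algebra set \<Rightarrow> 'g set \<Rightarrow> ('g \<Rightarrow> complex) \<Rightarrow> ('g uea \<times> 'g uea) set" where
  "verma_rel np H lam = {(a, b). a - b \<in> verma_ideal np H lam}"

text \<open>
  Since a type cannot depend on \<open>np\<close>, \<open>H\<close> and \<open>lam\<close>, the Verma module is a set of equivalence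
  classes with explicitly given operations.
\<close>

definition verma ::
    "'g :: lie_algebra set \<Rightarrow> 'g set \<Rightarrow> ('g \<Rightarrow> complex) \<Rightarrow> 'g uea set set" where
  "verma np H lam = UNIV // verma_rel np H lam"

definition verma_add ::
    "'g :: lie_algebra set \<Rightarrow> 'g set \<Rightarrow> ('g \<Rightarrow> complex) \<Rightarrow> 'g uea set \<Rightarrow> 'g uea set \<Rightarrow> 'g uea set" where
  "verma_add np H lam X Y = (\<Union>a\<in>X. \<Union>b\<in>Y. verma_rel np H lam `` {a + b})"

definition verma_cscale ::
    "'g :: lie_algebra set \<Rightarrow> 'g set \<Rightarrow> ('g \<Rightarrow> complex) \<Rightarrow> complex \<Rightarrow> 'g uea set \<Rightarrow> 'g uea set" where
  "verma_cscale np H lam c X = (\<Union>a\<in>X. verma_rel np H lam `` {c *\<^sub>C a})"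

definition verma_act ::
    "'g :: lie_algebra set \<Rightarrow> 'g set \<Rightarrow> ('g \<Rightarrow> complex) \<Rightarrow> 'g \<Rightarrow> 'g uea set \<Rightarrow> 'g uea set" where
  "verma_act np H lam x X = (\<Union>a\<in>X. verma_rel np H lam `` {\<iota> x * a})"

definition verma_hom ::
    "'g :: lie_algebra set \<Rightarrow> 'g set \<Rightarrow> ('g \<Rightarrow> complex) \<Rightarrow>
     ('g \<Rightarrow> 'v \<Rightarrow> 'v :: complex_vec) \<Rightarrow> ('g uea set \<Rightarrow> 'v) \<Rightarrow> bool" where
  "verma_hom np H lam act \<pi> \<longleftrightarrow>
     (\<forall>X\<in>verma np H lam. \<forall>Y\<in>verma np H lam. \<pi> (verma_add np H lam X Y) = \<pi> X + \<pi> Y) \<and>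
     (\<forall>c. \<forall>X\<in>verma np H lam. \<pi> (verma_cscale np H lam c X) = c *\<^sub>C \<pi> X) \<and>
     (\<forall>x. \<forall>X\<in>verma np H lam. \<pi> (verma_act np H lam x X) = act x (\<pi> X))"

definition highest_weight_module ::
    "'g :: lie_algebra set \<Rightarrow> 'g set \<Rightarrow> ('g \<Rightarrow> complex) \<Rightarrow>
     ('g \<Rightarrow> 'v \<Rightarrow> 'v :: complex_vec) \<Rightarrow> bool" where
  "highest_weight_module np H lam act \<longleftrightarrow>
     lie_module act \<and> (UNIV :: 'v set) \<noteq> {0} \<and>
     (\<exists>\<pi>. verma_hom np H lam act \<pi> \<and> \<pi> ` verma np H lam = UNIV)"

definition face_weights ::
    "'g :: lie_algebra set \<Rightarrow> ('i \<Rightarrow> 'g \<Rightarrow> complex) \<Rightarrow> ('g \<Rightarrow> complex) \<Rightarrow>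
     ('g \<Rightarrow> 'v \<Rightarrow> 'v :: complex_vec) \<Rightarrow> 'i set \<Rightarrow> ('g \<Rightarrow> complex) set" where
  "face_weights H \<alpha> lam act J =
     weights act H \<inter> {\<lambda>x. lam x - \<nu> x | \<nu>. \<nu> \<in> nonneg_combs \<alpha> J}"

end

theory Submission
  imports Defs
begin

text \<open>
  The weight \<open>lam - \<alpha> i\<close> always occurs: if the root space of \<open>- \<alpha> i\<close> annihilated the highest
  weight vector \<open>v\<close>, then so would \<open>[g_\<alpha>, g_{-\<alpha>}]\<close>, hence \<open>lam (h i)\<close> would vanish. By linear
  independence of the simple roots this weight lies in the face of \<open>J\<close> exactly when \<open>i \<in> J\<close>, so
  the face determines \<open>J\<close>.
\<close>

section \<open>The highest weight vector\<close>

text \<open>Scaling is left multiplication by a multiple of 1, so a left ideal of \<open>uea\<close>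
  is automatically closed under scalars.\<close>

lemma cscale_uea_eq_mult: "c *\<^sub>C a = (c *\<^sub>C 1) * (a :: 'g :: lie_algebra uea)"
  by transfer (rule env_rel_eqI, simp)

lemma verma_ideal_minus:
  "a \<in> verma_ideal np H lam \<Longrightarrow> - a \<in> verma_ideal np H lam"
  using verma_ideal.mult[of a np H lam "- 1"] by simp

lemma verma_ideal_cscale:
  "a \<in> verma_ideal np H lam \<Longrightarrow> c *\<^sub>C a \<in> verma_ideal np H lam"
  by (subst cscale_uea_eq_mult) (rule verma_ideal.mult)

lemma equiv_verma_rel: "equiv UNIV (verma_rel np H lam)"
proof (rule equivI)
  show "verma_rel np H lam \<subseteq> UNIV \<times> UNIV"
    by simp
  show "refl (verma_rel np H lam)"
    by (simp add: refl_on_def verma_rel_def verma_ideal.zero)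
  show "sym (verma_rel np H lam)"
    using verma_ideal_minus by (fastforce simp: sym_def verma_rel_def)
  show "trans (verma_rel np H lam)"
  proof (rule transI)
    fix a b c
    assume "(a, b) \<in> verma_rel np H lam" "(b, c) \<in> verma_rel np H lam"
    then have "(a - b) + (b - c) \<in> verma_ideal np H lam"
      by (intro verma_ideal.add) (simp_all add: verma_rel_def)
    then show "(a, c) \<in> verma_rel np H lam"
      by (simp add: verma_rel_def)
  qed
qed

section \<open>Verma module operations on representatives\<close>

abbreviation verma_class ::
    "'g :: lie_algebra set \<Rightarrow> 'g set \<Rightarrow> ('g \<Rightarrow> complex) \<Rightarrow> 'g uea \<Rightarrow> 'g uea set" where
  "verma_class np H lam a \<equiv> verma_rel np H lam `` {a}"

lemma verma_class_eqI:
  "a - b \<in> verma_ideal np H lam \<Longrightarrow> verma_class np H lam a = verma_class np H lam b"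
  by (rule equiv_class_eq[OF equiv_verma_rel]) (simp add: verma_rel_def)

lemma verma_class_in_verma: "verma_class np H lam a \<in> verma np H lam"
  by (simp add: verma_def quotientI)

text \<open>The ideal is closed under sums, so all pairs of representatives give the same class and
  the union collapses to it. With the two analogues below, computation with classes becomes
  computation in the enveloping algebra.\<close>

lemma verma_add_class:
  "verma_add np H lam (verma_class np H lam a) (verma_class np H lam b) =
     verma_class np H lam (a + b)"
  unfolding verma_add_def
proof (rule UN_equiv_class2[OF equiv_verma_rel equiv_verma_rel])
  show "congruent2 (verma_rel np H lam) (verma_rel np H lam) (\<lambda>a b. verma_class np H lam (a + b))"
  proof (rule congruent2I')
    fix a b c d
    assume "(a, b) \<in> verma_rel np H lam" "(c, d) \<in> verma_rel np H lam"
    then have "(a - b) + (c - d) \<in> verma_ideal np H lam"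
      by (intro verma_ideal.add) (simp_all add: verma_rel_def)
    then show "verma_class np H lam (a + c) = verma_class np H lam (b + d)"
      by (intro verma_class_eqI) (simp add: algebra_simps)
  qed
qed simp_all

lemma verma_cscale_class:
  "verma_cscale np H lam c (verma_class np H lam a) = verma_class np H lam (c *\<^sub>C a)"
  unfolding verma_cscale_def
proof (rule UN_equiv_class[OF equiv_verma_rel])
  show "(\<lambda>a. verma_class np H lam (c *\<^sub>C a)) respects verma_rel np H lam"
    by (intro congruentI verma_class_eqI)
      (metis cvec.scale_right_diff_distrib verma_ideal_cscale verma_rel_def case_prodD mem_Collect_eq)
qed simp

lemma verma_act_class:
  "verma_act np H lam x (verma_class np H lam a) = verma_class np H lam (\<iota> x * a)"
  unfolding verma_act_def
proof (rule UN_equiv_class[OF equiv_verma_rel])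
  show "(\<lambda>a. verma_class np H lam (\<iota> x * a)) respects verma_rel np H lam"
    by (intro congruentI verma_class_eqI)
      (metis right_diff_distrib verma_ideal.mult verma_rel_def case_prodD mem_Collect_eq)
qed simp

text \<open>The words in elements of the Lie algebra span the enveloping algebra, and each word is
  built from 1 by successive left multiplications. This gives the principle that a module map out of
  a Verma module is determined by the class of 1.\<close>

lemma uea_induct [case_names one cscale add \<iota>_mult]:
  fixes a :: "'g :: lie_algebra uea"
  assumes one: "P 1"
    and cscale: "\<And>c a. P a \<Longrightarrow> P (c *\<^sub>C a)"
    and add: "\<And>a b. P a \<Longrightarrow> P b \<Longrightarrow> P (a + b)"
    and \<iota>_mult: "\<And>x a. P a \<Longrightarrow> P (\<iota> x * a)"
  shows "P a"
proof -
  have word: "P (abs_uea (Poly_Mapping.single (Word xs) c))" for xs :: "'g list" and c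
  proof (induction xs)
    case Nil
    have "abs_uea (Poly_Mapping.single (Word []) c) = c *\<^sub>C (1 :: 'g uea)"
      by (simp add: one_uea_def cscale_uea.abs_eq scalar_def zero_free_monoid_def)
    then show ?case
      by (simp add: one cscale)
  next
    case (Cons x xs)
    have "Poly_Mapping.single (Word (x # xs)) c = gen x * Poly_Mapping.single (Word xs) c"
      by (simp add: gen_def mult_single plus_free_monoid_def)
    then have "abs_uea (Poly_Mapping.single (Word (x # xs)) c) =
        \<iota> x * abs_uea (Poly_Mapping.single (Word xs) c)"
      by (simp add: \<iota>_def times_uea.abs_eq)
    then show ?case
      by (simp add: \<iota>_mult Cons.IH)
  qed
  have "P (abs_uea p)" for p :: "'g free_algebra"
  proof (induction p rule: update_induct)
    case const
    then show ?case
      \<comment> \<open>The zero polynomial is the empty word with coefficient 0.\<close>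
      using word[of "[]" 0] by simp
  next
    case (update p u c)
    \<comment> \<open>The word \<open>u\<close> is not yet a key of \<open>p\<close>, so updating at
      \<open>u\<close> is the same as adding a monomial.\<close>
    then have "Poly_Mapping.update u c p = Poly_Mapping.single u c + p"
      by (intro poly_mapping_eqI) (auto simp: lookup_add lookup_single lookup_update in_keys_iff)
    moreover have "P (abs_uea (Poly_Mapping.single u c))"
      using word by (cases u) simp
    ultimately show ?case
      using add update.IH by (simp add: plus_uea.abs_eq[symmetric])
  qed
  then show ?thesis
    by (rule uea.abs_induct)
qed

text \<open>The vector is the image of the class of 1; its two annihilation properties are the
  images of the two kinds of generators of \<open>verma_ideal\<close>.\<close>

lemma highest_weight_vectorE:
  fixes act :: "'g :: lie_algebra \<Rightarrow> 'v \<Rightarrow> 'v :: complex_vec"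
  assumes "highest_weight_module np H lam act"
  obtains v where "v \<noteq> 0" "\<And>x. x \<in> np \<Longrightarrow> act x v = 0" "v \<in> weight_space act H lam"
proof -
  let ?cl = "verma_class np H lam"
  obtain \<pi> where act: "lie_module act" and nz: "(UNIV :: 'v set) \<noteq> {0}"
    and hom: "verma_hom np H lam act \<pi>" and surj: "\<pi> ` verma np H lam = UNIV"
    using assms unfolding highest_weight_module_def by blast
  have \<pi>_add: "\<pi> (?cl (a + b)) = \<pi> (?cl a) + \<pi> (?cl b)" for a b
    using hom verma_class_in_verma unfolding verma_hom_def by (metis verma_add_class)
  have \<pi>_cscale: "\<pi> (?cl (c *\<^sub>C a)) = c *\<^sub>C \<pi> (?cl a)" for a c
    using hom verma_class_in_verma unfolding verma_hom_def by (metis verma_cscale_class)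
  have \<pi>_act: "\<pi> (?cl (\<iota> x * a)) = act x (\<pi> (?cl a))" for a x
    using hom verma_class_in_verma unfolding verma_hom_def by (metis verma_act_class)
  have \<pi>_zero: "\<pi> (?cl 0) = 0"
    using \<pi>_cscale[of 0 0] by simp
  have act_zero: "act x 0 = 0" for x
    using act unfolding lie_module_def by (metis cvec.scale_zero_left)
  show thesis
  proof (rule that[of "\<pi> (?cl 1)"])
    show "\<pi> (?cl 1) \<noteq> 0"
    proof
      assume "\<pi> (?cl 1) = 0"
      \<comment> \<open>The class of 1 generates the Verma module, so \<open>\<pi>\<close> would
        vanish identically, although it maps onto a nonzero module.\<close>
      then have *: "\<pi> (?cl a) = 0" for a
        by (induction a rule: uea_induct) (simp_all add: \<pi>_add \<pi>_cscale \<pi>_act act_zero)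
      have "\<pi> X = 0" if X: "X \<in> verma np H lam" for X
      proof -
        obtain a where "X = ?cl a"
          using X unfolding verma_def by (rule quotientE)
        with * show ?thesis
          by metis
      qed
      then have "\<pi> ` verma np H lam \<subseteq> {0}"
        by (intro image_subsetI) simp
      with surj nz show False
        by (simp add: top_unique subset_singleton_iff)
    qed
    show "act x (\<pi> (?cl 1)) = 0" if "x \<in> np" for x
      using \<pi>_act[of x 1] \<pi>_zero verma_class_eqI[of "\<iota> x" 0] verma_ideal.np[OF that] by simp
    show "\<pi> (?cl 1) \<in> weight_space act H lam"
      unfolding weight_space_def
    proof safe
      fix x assume "x \<in> H"
      then have "?cl (\<iota> x) = ?cl (lam x *\<^sub>C 1)"
        by (intro verma_class_eqI verma_ideal.H)
      then show "act x (\<pi> (?cl 1)) = lam x *\<^sub>C \<pi> (?cl 1)"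
        using \<pi>_act[of x 1] \<pi>_cscale by simp
    qed
  qed
qed

section \<open>Weights of the form \<open>lam - \<alpha> i\<close>\<close>

text \<open>Moving \<open>x\<close> past \<open>f\<close> costs the commutator:
  \<open>x f v = [x, f] v + f x v\<close>, and the two terms contribute the summands \<beta> and
  \<mu> of the new weight.\<close>

lemma act_root_space_weight_space:
  assumes "lie_module act" and f: "f \<in> root_space H \<beta>" and v: "v \<in> weight_space act H \<mu>"
  shows "act f v \<in> weight_space act H (\<lambda>x. \<mu> x + \<beta> x)"
  unfolding weight_space_def
proof safe
  fix x assume x: "x \<in> H"
  have "bracket x f = \<beta> x *\<^sub>C f" "act x v = \<mu> x *\<^sub>C v"
    using f v x by (simp_all add: root_space_def weight_space_def)
  moreover have "act x (act f v) = act (bracket x f) v + act f (act x v)"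
    using assms(1) by (simp add: lie_module_def)
  ultimately show "act x (act f v) = (\<mu> x + \<beta> x) *\<^sub>C act f v"
    using assms(1) by (simp add: lie_module_def cscale_add_left add.commute)
qed

text \<open>Since \<open>[a, b] v = a b v - b a v\<close>, each bracket kills \<open>v\<close>, and
  linearity extends this to the span. The contrapositive later produces a lowering element that does
  not kill the highest weight vector.\<close>

lemma act_bracket_span_eq_zero:
  assumes act: "lie_module act"
    and A: "\<And>a. a \<in> A \<Longrightarrow> act a v = 0" and B: "\<And>b. b \<in> B \<Longrightarrow> act b v = 0"
    and t: "t \<in> bracket_span A B"
  shows "act t v = 0"
proof -
  have zero: "act x 0 = 0" "act 0 w = 0" for x w
    using act unfolding lie_module_def by (metis cvec.scale_zero_left)+
  show ?thesis
    using t unfolding bracket_span_def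
  proof (induction rule: cvec.span_induct_alt)
    case base
    show ?case by (rule zero)
  next
    case (step c x y)
    then obtain a b where "x = bracket a b" "a \<in> A" "b \<in> B"
      by blast
    with step act show ?case
      by (simp add: lie_module_def A B zero)
  qed
qed

section \<open>Independence of the simple roots\<close>

lemma simple_root_in_nonneg_combs:
  assumes "finite J" "i \<in> J"
  shows "\<alpha> i \<in> nonneg_combs \<alpha> J"
proof -
  have "\<alpha> i = (\<lambda>x. \<Sum>j\<in>J. of_nat (if j = i then 1 else 0) * \<alpha> j x)"
    using assms by (simp add: if_distrib[of of_nat] if_distrib[of "\<lambda>c. c * _"] cong: if_cong)
  then show ?thesis
    unfolding nonneg_combs_def mem_Collect_eq
    by (intro exI[of _ "\<lambda>j. if j = i then 1 else 0"] conjI TrueI)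
qed

text \<open>Writing a simple root as a combination of other simple roots would be a nontrivial
  linear relation among them.\<close>

lemma simple_root_in_nonneg_combs_iff:
  assumes simple: "simple_roots H I \<alpha>" and "i \<in> I" "J \<subseteq> I"
  shows "\<alpha> i \<in> nonneg_combs \<alpha> J \<longleftrightarrow> i \<in> J"
proof
  have fin: "finite I"
    using simple by (simp add: simple_roots_def)
  show "\<alpha> i \<in> nonneg_combs \<alpha> J" if "i \<in> J"
    using that assms(3) fin by (intro simple_root_in_nonneg_combs) (auto intro: finite_subset)
  assume "\<alpha> i \<in> nonneg_combs \<alpha> J"
  then obtain n :: "'b \<Rightarrow> nat" where n: "\<alpha> i = (\<lambda>x. \<Sum>j\<in>J. of_nat (n j) * \<alpha> j x)"
    unfolding nonneg_combs_def by blast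
  \<comment> \<open>Coefficients of the combination over \<open>J\<close> minus \<alpha> i, extended
    by zero to \<open>I\<close>; for \<open>i\<close> outside \<open>J\<close> the coefficient at
    \<open>i\<close> is -1.\<close>
  define c :: "'b \<Rightarrow> complex" where
    "c j = (if j \<in> J then of_nat (n j) else 0) - (if j = i then 1 else 0)" for j
  show "i \<in> J"
  proof (rule ccontr)
    assume "i \<notin> J"
    have "(\<Sum>j\<in>I. c j * \<alpha> j x) = 0" for x
    proof -
      have "(\<Sum>j\<in>I. c j * \<alpha> j x) =
          (\<Sum>j\<in>I. if j \<in> J then of_nat (n j) * \<alpha> j x else 0) - (\<Sum>j\<in>I. if j = i then \<alpha> j x else 0)"
        unfolding sum_subtractf[symmetric] by (rule sum.cong) (auto simp: c_def algebra_simps)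
      also have "(\<Sum>j\<in>I. if j \<in> J then of_nat (n j) * \<alpha> j x else 0) = (\<Sum>j\<in>J. of_nat (n j) * \<alpha> j x)"
        using fin assms(3) by (simp add: sum.inter_restrict[symmetric] Int_absorb1)
      also have "(\<Sum>j\<in>I. if j = i then \<alpha> j x else 0) = \<alpha> i x"
        using fin assms(2) by simp
      also have "(\<Sum>j\<in>J. of_nat (n j) * \<alpha> j x) = \<alpha> i x"
        using fun_cong[OF n, of x] by simp
      finally show ?thesis
        by simp
    qed
    then have "c i = 0"
      using simple assms(2) by (simp add: simple_roots_def)
    then show False
      using \<open>i \<notin> J\<close> by (simp add: c_def)
  qed
qed

lemma dual_space_diff:
  "\<phi> \<in> dual_space H \<Longrightarrow> \<psi> \<in> dual_space H \<Longrightarrow> (\<lambda>x. \<phi> x - \<psi> x) \<in> dual_space H"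
  by (simp add: dual_space_def algebra_simps)

lemma diff_simple_root_in_weights:
  assumes tri: "triangular_decomposition np H nm I \<alpha>" and i: "i \<in> I"
    and coroot: "is_coroot H (\<alpha> i) t"
    and lam: "lam \<in> dual_space H" "lam t \<noteq> 0"
    and hw: "highest_weight_module np H lam act"
  shows "(\<lambda>x. lam x - \<alpha> i x) \<in> weights act H"
proof -
  have simple: "simple_roots H I \<alpha>"
    using tri by (simp add: triangular_decomposition_def)
  then have root: "\<alpha> i \<in> roots H"
    using i by (auto simp: simple_roots_def)
  have act: "lie_module act"
    using hw by (simp add: highest_weight_module_def)
  obtain v where v: "v \<noteq> 0" "\<And>x. x \<in> np \<Longrightarrow> act x v = 0" "v \<in> weight_space act H lam"
    using highest_weight_vectorE[OF hw] by blast
  \<comment> \<open>Positivity puts the root space of \<alpha> i inside \<open>np\<close>, which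
    annihilates \<open>v\<close>.\<close>
  have "\<alpha> i \<in> positive_roots H I \<alpha>"
    using simple_root_in_nonneg_combs_iff[OF simple i subset_refl] root i
    by (simp add: positive_roots_def)
  then have "root_space H (\<alpha> i) \<subseteq> np"
    using tri by (auto simp: triangular_decomposition_def intro: cvec.span_base)
  then have e: "act e v = 0" if "e \<in> root_space H (\<alpha> i)" for e
    using v(2) that by blast
  \<comment> \<open>Elements of \<open>dual_space H\<close> are 0 off \<open>H\<close> by
    convention, so \<open>lam t\<close> being nonzero already forces \<open>t\<close> into
    \<open>H\<close>.\<close>
  have "t \<in> H"
    using lam by (auto simp: dual_space_def)
  then have "act t v \<noteq> 0"
    using v lam(2) by (simp add: weight_space_def)
  \<comment> \<open>The coroot \<open>t\<close> lies in the span of brackets of the two opposite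
    root spaces and acts on \<open>v\<close> by the nonzero scalar \<open>lam t\<close>; as the
    positive one kills \<open>v\<close>, the negative one cannot.\<close>
  then obtain f where f: "f \<in> root_space H (\<lambda>x. - \<alpha> i x)" "act f v \<noteq> 0"
    using act_bracket_span_eq_zero[OF act, where v = v] e coroot unfolding is_coroot_def by metis
  have "act f v \<in> weight_space act H (\<lambda>x. lam x - \<alpha> i x)"
    using act_root_space_weight_space[OF act f(1) v(3)] by simp
  moreover have "(\<lambda>x. lam x - \<alpha> i x) \<in> dual_space H"
    using lam(1) root by (intro dual_space_diff) (simp_all add: roots_def weights_def)
  ultimately show ?thesis
    using f(2) by (auto simp: weights_def)
qed

theorem corollary3p16:
  fixes np H nm :: "'g :: lie_algebra set"
    and I :: "'i set"
    and \<alpha> :: "'i \<Rightarrow> 'g \<Rightarrow> complex"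
    and h :: "'i \<Rightarrow> 'g"
    and lam :: "'g \<Rightarrow> complex"
    and act :: "'g \<Rightarrow> 'v \<Rightarrow> 'v :: complex_vec"
  assumes "finite_dim TYPE('g)" and "semisimple TYPE('g)"
    and "triangular_decomposition np H nm I \<alpha>"
    and "\<And>i. i \<in> I \<Longrightarrow> is_coroot H (\<alpha> i) (h i)"
    and "lam \<in> dual_space H"
    and "\<And>i. i \<in> I \<Longrightarrow> lam (h i) \<noteq> 0"
    and "highest_weight_module np H lam act"
  shows "inj_on (face_weights H \<alpha> lam act) (Pow I)"
proof (rule inj_onI)
  fix J K
  assume JK: "J \<in> Pow I" "K \<in> Pow I"
    and eq: "face_weights H \<alpha> lam act J = face_weights H \<alpha> lam act K"
  have simple: "simple_roots H I \<alpha>"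
    using assms(3) by (simp add: triangular_decomposition_def)
  \<comment> \<open>The test weight depends on \<open>i\<close> but not on \<open>L\<close>, so it
    can be compared across the equal faces of \<open>J\<close> and \<open>K\<close>.\<close>
  have mem: "i \<in> L \<longleftrightarrow> (\<lambda>x. lam x - \<alpha> i x) \<in> face_weights H \<alpha> lam act L"
    if "i \<in> I" "L \<subseteq> I" for i L
  proof -
    have "(\<lambda>x. lam x - \<alpha> i x) \<in> {\<lambda>x. lam x - \<nu> x | \<nu>. \<nu> \<in> nonneg_combs \<alpha> L} \<longleftrightarrow>
        \<alpha> i \<in> nonneg_combs \<alpha> L"
    proof
      assume "(\<lambda>x. lam x - \<alpha> i x) \<in> {\<lambda>x. lam x - \<nu> x | \<nu>. \<nu> \<in> nonneg_combs \<alpha> L}"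
      then obtain \<nu> where "\<nu> \<in> nonneg_combs \<alpha> L" "(\<lambda>x. lam x - \<alpha> i x) = (\<lambda>x. lam x - \<nu> x)"
        by blast
      then show "\<alpha> i \<in> nonneg_combs \<alpha> L"
        \<comment> \<open>Cancelling \<open>lam\<close> pointwise identifies \<nu> with \<alpha>
          i.\<close>
        by (metis diff_left_imp_eq ext)
    qed blast
    then show ?thesis
      using simple_root_in_nonneg_combs_iff[OF simple that]
        diff_simple_root_in_weights[OF assms(3) that(1) assms(4)[OF that(1)] assms(5)
          assms(6)[OF that(1)] assms(7)]
      by (simp add: face_weights_def)
  qed
  show "J = K"
    using JK eq mem by blast
qed

end
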